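(* Let $d\ge3$ be a constant and let $G=(V,\mathcal{E})$ be an implicit $(d,c)$-grid graph with $1\le c\le s^{1/d^3}$. For every constant $\alpha\in(0,1)$ there exists a Las Vegas MPC algorithm with local memory $\Theta(s)\subseteq\Theta(|V|^{\alpha})$ per machine which computes a pseudo $s$-separator of $G$ in $O(1)$ rounds with high probability.
   Context: An implicit graph $G=(V,\mathcal{E})$ consists of a node set $V$, each node carrying $O(1)$ words of information, and an edge formation rule $\mathcal{E}$ deciding adjacency (and weight) of two distinct nodes from their information; it is an implicit $(d,c)$-grid graph if the resulting explicit graph has nodes in $\mathbb{N}^d$ and every edge $(u,v)$ satisfies $0<\|u-v\|_\infty\le c$. A pseudo $s$-separator of $G$ is a set $S\subseteq V$ such that $|S|\in O\!\left(\frac{c|V|}{s^{1/d}}\log s\right)$ and removing $S$ disconnects $G$ into $h\in O(|V|/s)$ induced subgraphs $G_i=(V_i,\mathcal{E})$ with pairwise disjoint $V_i\subset V$ and $|V_i|\in O(s)$ (no edge joins different $V_i$). MPC model: input evenly distributed over $m$ machines, each with local memory $\Theta(s)$, $s=|V|^{\alpha}$; synchronous rounds in which each machine sends/receives $O(s)$ words, then computes locally. Las Vegas: never wrong; with high probability: probability $\ge 1-1/|V|^{\Omega(1)}$. *)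

theory Defs
  imports "HOL-Probability.Probability" "HOL-Probability.Product_PMF" "HOL-Library.Landau_Symbols"
begin

section \<open>Implicit graphs\<close>

text \<open>A word is a natural number below \<open>2 ^ b\<close>, where \<open>b\<close> is the word size of the machines.\<close>

type_synonym word = nat

definition words :: "nat \<Rightarrow> word list \<Rightarrow> bool" where
  "words b ws \<longleftrightarrow> (\<forall>w\<in>set ws. w < 2 ^ b)"

text \<open>The edge formation rule only sees the information of the two nodes. It yields \<open>None\<close> for
  non-adjacent nodes and the weight of the edge otherwise.\<close>

type_synonym formation_rule = "word list \<Rightarrow> word list \<Rightarrow> real option"

record 'v implicit_graph =
  nodes :: "'v set"
  info :: "'v \<Rightarrow> word list"
  edge_rule :: formation_rule

text \<open>The constant \<open>k\<close> is the number of words per node (shorter information is padded). Word size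
  \<open>b\<close> is large enough to index the nodes; \<open>b = \<Theta>(log |V|)\<close> is the usual choice, but the
  coordinates of a grid graph need not be polynomially bounded, so \<open>b\<close> is left free.\<close>

definition implicit_graph :: "nat \<Rightarrow> nat \<Rightarrow> 'v implicit_graph \<Rightarrow> bool" where
  "implicit_graph k b G \<longleftrightarrow>
     finite (nodes G) \<and> nodes G \<noteq> {} \<and> card (nodes G) \<le> 2 ^ b \<and>
     (\<forall>v\<in>nodes G. length (info G v) = k \<and> words b (info G v)) \<and>
     (\<forall>u\<in>nodes G. \<forall>v\<in>nodes G. edge_rule G (info G u) (info G v) = edge_rule G (info G v) (info G u))"

definition adjacent :: "'v implicit_graph \<Rightarrow> 'v \<Rightarrow> 'v \<Rightarrow> bool" where
  "adjacent G u v \<longleftrightarrow>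
     u \<in> nodes G \<and> v \<in> nodes G \<and> u \<noteq> v \<and> edge_rule G (info G u) (info G v) \<noteq> None"

text \<open>Points of \<open>\<nat>\<^sup>d\<close> are lists of length \<open>d\<close>.\<close>

type_synonym point = "nat list"

definition linf_dist :: "point \<Rightarrow> point \<Rightarrow> int" where
  "linf_dist u v = Max ((\<lambda>i. \<bar>int (u ! i) - int (v ! i)\<bar>) ` {..<length u})"

text \<open>The coordinates of a node are the first \<open>d\<close> words of its information.\<close>

definition implicit_grid_graph :: "nat \<Rightarrow> real \<Rightarrow> nat \<Rightarrow> nat \<Rightarrow> point implicit_graph \<Rightarrow> bool" where
  "implicit_grid_graph d c k b G \<longleftrightarrow>
     implicit_graph k b G \<and>
     (\<forall>v\<in>nodes G. length v = d \<and> take d (info G v) = v) \<and>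
     (\<forall>u v. adjacent G u v \<longrightarrow> 0 < linf_dist u v \<and> real_of_int (linf_dist u v) \<le> c)"

section \<open>Pseudo separators\<close>

text \<open>\<open>C\<close> is a common constant for the three asymptotic upper bounds; it has to be chosen
  before the graph. The parts \<open>Vs i\<close> need not be connected.\<close>

definition pseudo_separator ::
    "real \<Rightarrow> nat \<Rightarrow> real \<Rightarrow> real \<Rightarrow> 'v implicit_graph \<Rightarrow> 'v set \<Rightarrow> bool" where
  "pseudo_separator C d c s G S \<longleftrightarrow>
     S \<subseteq> nodes G \<and>
     real (card S) \<le> C * (c * real (card (nodes G)) / s powr (1 / real d) * log 2 s) \<and>
     (\<exists>(h::nat) Vs.
        real h \<le> C * (real (card (nodes G)) / s) \<and>
        nodes G - S = (\<Union>i<h. Vs i) \<and>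
        disjoint_family_on Vs {..<h} \<and>
        (\<forall>i<h. real (card (Vs i)) \<le> C * s) \<and>
        (\<forall>i<h. \<forall>j<h. i \<noteq> j \<longrightarrow> (\<forall>u\<in>Vs i. \<forall>v\<in>Vs j. \<not> adjacent G u v)))"

section \<open>The MPC model\<close>

text \<open>A machine is either active, with a memory of words, or it has stopped and holds its part of
  the output, a list of points.\<close>

datatype mstate = Active "word list" | Done "point list"

primrec content :: "mstate \<Rightarrow> word list" where
  "content (Active ws) = ws"
| "content (Done ps) = concat ps"

text \<open>\<open>send P i ws j\<close> is the message which machine \<open>i\<close> with memory \<open>ws\<close> sends to machine \<open>j\<close>.
  After the exchange, \<open>compute P i ws inbox\<close> is the distribution of the next state of machine
  \<open>i\<close>, where \<open>inbox j\<close> is the message received from \<open>j\<close>. Local computation is unrestricted.\<close>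

record mpc_program =
  send :: "nat \<Rightarrow> word list \<Rightarrow> nat \<Rightarrow> word list"
  compute :: "nat \<Rightarrow> word list \<Rightarrow> (nat \<Rightarrow> word list) \<Rightarrow> mstate pmf"

type_synonym config = "nat \<Rightarrow> mstate"

definition message :: "mpc_program \<Rightarrow> config \<Rightarrow> nat \<Rightarrow> nat \<Rightarrow> word list" where
  "message P \<sigma> i j = (case \<sigma> i of Active ws \<Rightarrow> send P i ws j | Done ps \<Rightarrow> [])"

definition mpc_round :: "nat \<Rightarrow> mpc_program \<Rightarrow> config \<Rightarrow> config pmf" where
  "mpc_round m P \<sigma> = Pi_pmf {..<m} (Done [])
     (\<lambda>i. case \<sigma> i of
        Active ws \<Rightarrow> compute P i ws (\<lambda>j. if j < m then message P \<sigma> j i else [])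
      | Done ps \<Rightarrow> return_pmf (Done ps))"

primrec mpc_run :: "nat \<Rightarrow> mpc_program \<Rightarrow> config \<Rightarrow> nat \<Rightarrow> config pmf" where
  "mpc_run m P \<sigma> 0 = return_pmf \<sigma>"
| "mpc_run m P \<sigma> (Suc r) = bind_pmf (mpc_run m P \<sigma> r) (mpc_round m P)"

definition respects_resources :: "nat \<Rightarrow> nat \<Rightarrow> nat \<Rightarrow> mpc_program \<Rightarrow> config \<Rightarrow> bool" where
  "respects_resources m b M P \<sigma> \<longleftrightarrow>
     (\<forall>i<m. length (content (\<sigma> i)) \<le> M \<and> words b (content (\<sigma> i)) \<and>
            (\<Sum>j<m. length (message P \<sigma> i j)) \<le> M \<and>
            (\<Sum>j<m. length (message P \<sigma> j i)) \<le> M \<and>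
            (\<forall>j<m. words b (message P \<sigma> i j)))"

definition halted :: "nat \<Rightarrow> config \<Rightarrow> bool" where
  "halted m \<sigma> \<longleftrightarrow> (\<forall>i<m. \<exists>ps. \<sigma> i = Done ps)"

definition run_output :: "nat \<Rightarrow> config \<Rightarrow> point set" where
  "run_output m \<sigma> = {p. \<exists>i<m. \<exists>ps. \<sigma> i = Done ps \<and> p \<in> set ps}"

definition evenly_distributed :: "nat \<Rightarrow> 'v set \<Rightarrow> (nat \<Rightarrow> 'v list) \<Rightarrow> bool" where
  "evenly_distributed m V inp \<longleftrightarrow>
     distinct (concat (map inp [0..<m])) \<and> set (concat (map inp [0..<m])) = V \<and>
     (\<forall>i<m. \<lfloor>real (card V) / real m\<rfloor> \<le> int (length (inp i)) \<and>
            int (length (inp i)) \<le> \<lceil>real (card V) / real m\<rceil>)"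

definition initial_config :: "nat \<Rightarrow> 'v implicit_graph \<Rightarrow> (nat \<Rightarrow> 'v list) \<Rightarrow> config" where
  "initial_config m G inp =
     (\<lambda>i. if i < m then Active (concat (map (info G) (inp i))) else Done [])"

text \<open>The resource bounds hold and the output is correct on every possible run, and a run halts
  with probability 1; only the number of rounds is random.\<close>

definition las_vegas ::
    "nat \<Rightarrow> nat \<Rightarrow> nat \<Rightarrow> mpc_program \<Rightarrow> config \<Rightarrow> (point set \<Rightarrow> bool) \<Rightarrow> bool" where
  "las_vegas m b M P \<sigma>\<^sub>0 correct \<longleftrightarrow>
     (\<forall>r. \<forall>\<sigma>\<in>set_pmf (mpc_run m P \<sigma>\<^sub>0 r).
        respects_resources m b M P \<sigma> \<and> (halted m \<sigma> \<longrightarrow> correct (run_output m \<sigma>))) \<and>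
     (\<lambda>r. measure_pmf.prob (mpc_run m P \<sigma>\<^sub>0 r) {\<sigma>. halted m \<sigma>}) \<longlonglongrightarrow> 1"

end

theory Submission imports Defs "HOL-Real_Asymp.Real_Asymp" begin

text \<open>Cut every coordinate axis into intervals of length \<open>w = \<lceil>c\<rceil>\<close> and number them cyclically
  modulo \<open>B\<close>, where \<open>B\<close> is of order \<open>s powr (1 / d) / c\<close> and \<open>B * w \<le> s powr (1 / d)\<close>. For a residue
  \<open>t\<close>, deleting the nodes with some coordinate in an interval of class \<open>t\<close> leaves cubic cells of
  side less than \<open>B * w\<close> that are pairwise more than \<open>c\<close> apart; each has at most \<open>s\<close> nodes, and
  merging small cells leaves \<open>O(n / s)\<close> parts. A node is deleted for at most \<open>d\<close> of the \<open>B\<close>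
  residues, so the best \<open>t\<close> deletes at most \<open>d * n / B\<close> nodes, which even saves the factor \<open>log s\<close>.
  As \<open>B \<le> s powr (1 / 2)\<close>, a histogram over all \<open>t\<close> fits into one machine together with those
  of about \<open>s powr (1 / 2)\<close> children; hence a tree of this arity and of constant depth adds up the
  histograms, and the best \<open>t\<close> is broadcast back. No randomness is needed.\<close>

section \<open>Separation by slabs\<close>

definition hit :: "nat \<Rightarrow> nat \<Rightarrow> nat \<Rightarrow> point \<Rightarrow> bool" where
  "hit w B t p \<longleftrightarrow> (\<exists>x\<in>set p. x div w mod B = t)"

text \<open>Adding \<open>B - t\<close> moves class \<open>t\<close> to residue 0, so every block of
  \<open>B\<close> consecutive intervals opens with a deleted one. For \<open>t < B\<close> this
  shift avoids negative indices.\<close>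

definition cell :: "nat \<Rightarrow> nat \<Rightarrow> nat \<Rightarrow> point \<Rightarrow> nat list" where
  "cell w B t p = map (\<lambda>x. (x div w + (B - t)) div B) p"

text \<open>The block of \<open>y\<close> opens with a deleted interval, which does not contain
  \<open>y\<close>; this whole interval of length \<open>w\<close> separates \<open>y\<close> from
  \<open>x\<close> in an earlier block.\<close>

lemma coordinates_far_apart:
  fixes w B t x y :: nat
  assumes "0 < w" "t < B" and x: "x div w mod B \<noteq> t"
    and y: "y div w mod B \<noteq> t"
    and lt: "(x div w + (B - t)) div B < (y div w + (B - t)) div B"
  shows "x + w < y"
proof -
  define p q where "p = x div w" and "q = y div w"
  define a a' where "a = (p + (B - t)) div B" and "a' = (q + (B - t)) div B"
  have "(q + (B - t)) mod B \<noteq> 0"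
  proof
    assume "(q + (B - t)) mod B = 0"
    then have "(q + (B - t) + t) mod B = t mod B"
      by (metis add_0 mod_add_left_eq)
    then show False
      using y \<open>t < B\<close> by (simp add: q_def)
  qed
  then have "q + (B - t) \<ge> a' * B + 1"
    unfolding a'_def by (metis One_nat_def Suc_leI add_Suc_right add.right_neutral div_mult_mod_eq
        less_add_same_cancel1 neq0_conv)
  moreover have "p + (B - t) < (a + 1) * B"
    unfolding a_def using \<open>t < B\<close>
    by (metis Suc_eq_plus1 dividend_less_times_div less_nat_zero_code
        mult.commute mult_Suc_right neq0_conv)
  moreover have "(a + 1) * B \<le> a' * B"
    using lt unfolding a_def a'_def p_def q_def by (intro mult_right_mono) auto
  ultimately have "p + 2 \<le> q" by linarith
  then have "w * (p + 2) \<le> w * q" by (rule mult_left_mono) simp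
  moreover have "x < w * (p + 1)"
    using \<open>0 < w\<close> dividend_less_times_div[of w x] by (simp add: p_def)
  moreover have "w * q \<le> y" by (simp add: q_def)
  ultimately show ?thesis by (simp add: algebra_simps)
qed

lemma linf_dist_ge:
  assumes "i < length u"
  shows "\<bar>int (u ! i) - int (v ! i)\<bar> \<le> linf_dist u v"
  unfolding linf_dist_def using assms by (intro Max_ge) auto

lemma linf_dist_of_cell_neq:
  assumes "0 < w" "t < B" "length u = length v" "\<not> hit w B t u" "\<not> hit w B t v"
    and "cell w B t u \<noteq> cell w B t v"
  shows "int w < linf_dist u v"
proof -
  obtain i where i: "i < length u" "cell w B t u ! i \<noteq> cell w B t v ! i"
    using assms(3,6) by (metis cell_def length_map nth_equalityI)
  have u: "u ! i div w mod B \<noteq> t" and v: "v ! i div w mod B \<noteq> t"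
    using assms(3-5) i(1) by (auto simp: hit_def)
  have "u ! i + w < v ! i \<or> v ! i + w < u ! i"
    using coordinates_far_apart[OF assms(1,2) u v] coordinates_far_apart[OF assms(1,2) v u] i assms(3)
    by (auto simp: cell_def neq_iff)
  then show ?thesis
    using linf_dist_ge[OF i(1), of v] by linarith
qed

text \<open>The cell fixes the quotients of the shifted coordinates by \<open>B * w\<close>, so the
  remainders alone determine the point.\<close>

lemma card_cell_le:
  assumes "0 < w" "t < B" and len: "\<And>v. v \<in> V \<Longrightarrow> length v = d"
  shows "card {v \<in> V. cell w B t v = a} \<le> (B * w) ^ d"
proof -
  define e where "e = (B - t) * w"
  define F where "F = map (\<lambda>x. (x + e) mod (B * w))"
  have div: "(x div w + (B - t)) div B = (x + e) div (B * w)" for x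
    using assms(1) by (simp add: e_def mult.commute[of B w] div_mult2_eq add.commute)
  have "inj_on F {v \<in> V. cell w B t v = a}"
  proof (rule inj_onI)
    fix u v
    assume u: "u \<in> {v \<in> V. cell w B t v = a}" and v: "v \<in> {v \<in> V. cell w B t v = a}"
      and F: "F u = F v"
    have l: "length u = length v" using u v len by auto
    have "u ! i = v ! i" if i: "i < length u" for i
    proof -
      have "cell w B t u ! i = cell w B t v ! i" using u v by simp
      then have "(u ! i + e) div (B * w) = (v ! i + e) div (B * w)"
        using i l by (simp add: cell_def div)
      moreover have "(u ! i + e) mod (B * w) = (v ! i + e) mod (B * w)"
        using arg_cong[OF F, of "\<lambda>z. z ! i"] i l by (simp add: F_def)
      ultimately have "u ! i + e = v ! i + e" by (metis div_mult_mod_eq)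
      then show ?thesis by simp
    qed
    then show "u = v" using l by (simp add: nth_equalityI)
  qed
  moreover have "F ` {v \<in> V. cell w B t v = a} \<subseteq> {xs. set xs \<subseteq> {..<B * w} \<and> length xs = d}"
    using len assms by (auto simp: F_def)
  ultimately have "card {v \<in> V. cell w B t v = a}
      \<le> card {xs. set xs \<subseteq> {..<B * w} \<and> length xs = d}"
    by (intro card_inj_on_le[where f = F]) (auto simp: finite_lists_length_eq)
  then show ?thesis by (simp add: card_lists_length_eq)
qed

text \<open>Double counting: each coordinate lies in an interval of exactly one class, so a point is
  hit for at most \<open>d\<close> values of \<open>t\<close>.\<close>

lemma sum_card_hit_le:
  assumes "finite V" "0 < B" "\<And>v. v \<in> V \<Longrightarrow> length v = d"
  shows "(\<Sum>t<B. card {v \<in> V. hit w B t v}) \<le> d * card V"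
proof -
  have "(\<Sum>t<B. card {v \<in> V. hit w B t v}) = (\<Sum>t<B. \<Sum>v\<in>V. if hit w B t v then 1 else 0)"
    using assms(1) by (simp add: sum.If_cases Int_def)
  also have "\<dots> = (\<Sum>v\<in>V. \<Sum>t<B. if hit w B t v then 1 else 0)"
    by (rule sum.swap)
  also have "\<dots> \<le> (\<Sum>v\<in>V. d)"
  proof (rule sum_mono)
    fix v assume v: "v \<in> V"
    have "(\<Sum>t<B. if hit w B t v then 1 else 0) = card {t \<in> {..<B}. hit w B t v}"
      by (simp add: sum.If_cases Int_def)
    also have "\<dots> \<le> card ((\<lambda>x. x div w mod B) ` set v)"
      by (intro card_mono) (auto simp: hit_def)
    also have "\<dots> \<le> length v"
      by (meson card_image_le card_length finite_set le_trans)
    finally show "(\<Sum>t<B. if hit w B t v then 1 else 0) \<le> d" using assms(3) v by simp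
  qed
  finally show ?thesis by (simp add: mult.commute)
qed

section \<open>Grouping the cells\<close>

text \<open>A new group is opened only when the current one exceeds \<open>T\<close>, so all but the last are heavy.\<close>

lemma grouping_aux:
  fixes wt :: "'a \<Rightarrow> nat"
  assumes "finite F" "\<And>x. x \<in> F \<Longrightarrow> wt x \<le> T"
  shows "\<exists>(g :: 'a \<Rightarrow> nat) h. (\<forall>x\<in>F. g x \<le> h) \<and> (\<forall>i\<le>h. sum wt {x \<in> F. g x = i} \<le> 2 * T)
    \<and> (\<forall>i<h. T \<le> sum wt {x \<in> F. g x = i})"
  using assms
proof (induction F rule: finite_induct)
  case empty
  show ?case by (rule exI, rule exI[of _ 0]) simp
next
  case (insert x F)
  have "\<exists>(g :: 'a \<Rightarrow> nat) h. (\<forall>x\<in>F. g x \<le> h) \<and>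
    (\<forall>i\<le>h. sum wt {x \<in> F. g x = i} \<le> 2 * T) \<and> (\<forall>i<h. T \<le> sum wt {x \<in> F. g x = i})"
    by (rule insert.IH) (use insert.prems in auto)
  then obtain g :: "'a \<Rightarrow> nat" and h where g: "\<forall>x\<in>F. g x \<le> h"
    "\<forall>i\<le>h. sum wt {x \<in> F. g x = i} \<le> 2 * T" "\<forall>i<h. T \<le> sum wt {x \<in> F. g x = i}"
    by blast
  \<comment> \<open>The new item joins a group of weight at most \<open>T\<close>, which keeps the
    bound \<open>2 * T\<close>; a group that is left behind weighs more than
    \<open>T\<close>.\<close>
  define h' where "h' = (if sum wt {x \<in> F. g x = h} \<le> T then h else Suc h)"
  define g' where "g' = g(x := h')"
  have eq: "sum wt {y \<in> insert x F. g' y = i} = (if i = h' then wt x else 0) + sum wt {y \<in> F. g y = i}"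
    for i
  proof -
    have "{y \<in> insert x F. g' y = i} = (if i = h' then {x} else {}) \<union> {y \<in> F. g y = i}"
      using insert.hyps by (auto simp: g'_def)
    then show ?thesis using insert.hyps by auto
  qed
  have new: "sum wt {y \<in> F. g y = Suc h} = 0"
    using g(1) by (intro sum.neutral) auto
  have x: "wt x \<le> T" using insert.prems by simp
  show ?case
  proof (intro exI[of _ g'] exI[of _ h'] conjI ballI allI impI)
    show "g' y \<le> h'" if "y \<in> insert x F" for y
      using that g(1) by (fastforce simp: g'_def h'_def)
    show "sum wt {y \<in> insert x F. g' y = i} \<le> 2 * T" if "i \<le> h'" for i
    proof (cases "i = Suc h")
      case True
      then show ?thesis using eq[of i] new x by simp
    next
      case False
      then have "i \<le> h" using that by (auto simp: h'_def split: if_splits)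
      then show ?thesis using eq[of i] g(2) x by (auto simp: h'_def split: if_splits)
    qed
    show "T \<le> sum wt {y \<in> insert x F. g' y = i}" if "i < h'" for i
      using that eq[of i] g(3) by (auto simp: h'_def less_Suc_eq split: if_splits)
  qed
qed

lemma grouping:
  fixes wt :: "'a \<Rightarrow> nat"
  assumes F: "finite F" and "\<And>x. x \<in> F \<Longrightarrow> wt x \<le> T"
  obtains g :: "'a \<Rightarrow> nat" and h where "\<And>x. x \<in> F \<Longrightarrow> g x \<le> h" "\<And>i. i \<le> h \<Longrightarrow> sum wt {x \<in> F. g x = i} \<le> 2 * T"
    "h * T \<le> sum wt F"
proof -
  obtain g :: "'a \<Rightarrow> nat" and h where g: "\<forall>x\<in>F. g x \<le> h" "\<forall>i\<le>h. sum wt {x \<in> F. g x = i} \<le> 2 * T"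
    "\<forall>i<h. T \<le> sum wt {x \<in> F. g x = i}"
    using grouping_aux[of F wt T] assms by blast
  have "h * T = (\<Sum>i<h. T)" by simp
  also have "\<dots> \<le> (\<Sum>i<h. sum wt {x \<in> F. g x = i})"
    using g(3) by (intro sum_mono) auto
  also have "\<dots> \<le> (\<Sum>i\<le>h. sum wt {x \<in> F. g x = i})"
    by (intro sum_mono2) auto
  also have "\<dots> = sum wt F"
    using F g(1) by (intro sum.group) auto
  finally show ?thesis using that g by blast
qed

section \<open>From slabs to pseudo separators\<close>

lemma slab_pseudo_separator:
  assumes G: "implicit_grid_graph d c k b G" and n: "n = card (nodes G)"
    and s: "1 \<le> s" "s \<le> real n" and c: "c \<le> real w"
    and w: "0 < w" and t: "t < B" and cap: "real ((B * w) ^ d) \<le> s"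
    and S: "S = {v \<in> nodes G. hit w B t v}"
    and small: "real (card S) \<le> C * (c * real n / s powr (1 / real d) * log 2 s)"
    and C: "3 \<le> C"
  shows "pseudo_separator C d c s G S"
proof -
  let ?V = "nodes G - S"
  have fin: "finite (nodes G)" and len: "\<And>v. v \<in> nodes G \<Longrightarrow> length v = d"
    and adj: "\<And>u v. adjacent G u v \<Longrightarrow> real_of_int (linf_dist u v) \<le> c"
    using G by (auto simp: implicit_grid_graph_def implicit_graph_def)
  \<comment> \<open>Weights are integers, so \<open>s\<close> is rounded down; as
    \<open>1 \<le> s\<close>, this loses at most a factor of two.\<close>
  define T where "T = nat \<lfloor>s\<rfloor>"
  have "1 \<le> \<lfloor>s\<rfloor>" using s(1) by simp
  then have T: "real T \<le> s" "s \<le> 2 * real T" "0 < T"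
    unfolding T_def by linarith+
  define wt where "wt a = card {v \<in> ?V. cell w B t v = a}" for a
  have "real (wt a) \<le> s" for a
  proof -
    have "wt a \<le> (B * w) ^ d" unfolding wt_def using w t len by (intro card_cell_le) auto
    then show ?thesis using cap by linarith
  qed
  then have wt: "wt a \<le> T" for a unfolding T_def by (intro le_nat_floor)
  let ?F = "cell w B t ` ?V"
  have sum_wt: "sum wt A = card {v \<in> ?V. cell w B t v \<in> A}" if "A \<subseteq> ?F" for A
  proof -
    have "finite A" using that fin by (meson finite_Diff finite_imageI finite_subset)
    moreover have "{v \<in> ?V. cell w B t v \<in> A} = (\<Union>a\<in>A. {v \<in> ?V. cell w B t v = a})" by auto
    ultimately show ?thesis unfolding wt_def using fin by (simp only:) (subst card_UN_disjoint; auto)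
  qed
  obtain g h where g: "\<And>x. x \<in> ?F \<Longrightarrow> g x \<le> h"
      "\<And>i. i \<le> h \<Longrightarrow> sum wt {x \<in> ?F. g x = i} \<le> 2 * T" "h * T \<le> sum wt ?F"
    using grouping[of ?F wt T] fin wt by blast
  define Vs where "Vs i = {v \<in> ?V. g (cell w B t v) = i}" for i
  have "h * T \<le> n"
  proof -
    have "sum wt ?F \<le> n" unfolding n sum_wt[OF subset_refl] using fin by (intro card_mono) auto
    then show ?thesis using g(3) by linarith
  qed
  then have "real h * real T \<le> real n" by (metis of_nat_le_iff of_nat_mult)
  moreover have "real h * s \<le> real h * (2 * real T)" using T by (intro mult_left_mono) auto
  \<comment> \<open>The groups are numbered from 0 to \<open>h\<close>. The first \<open>h\<close>
    contribute \<open>h * s \<le> 2 * h * T \<le> 2 * n\<close>, the last one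
    \<open>s \<le> n\<close>; hence the constant 3.\<close>
  ultimately have "(real h + 1) * s \<le> 3 * real n"
    using s by (simp add: algebra_simps)
  then have "real (Suc h) \<le> 3 * (real n / s)" using s by (simp add: field_simps)
  also have "\<dots> \<le> C * (real n / s)" using s C by (intro mult_right_mono) auto
  finally have h: "real (Suc h) \<le> C * (real n / s)" .
  have size: "real (card (Vs i)) \<le> C * s" if "i < Suc h" for i
  proof -
    have "Vs i = {v \<in> ?V. cell w B t v \<in> {x \<in> ?F. g x = i}}" by (auto simp: Vs_def)
    then have "card (Vs i) = sum wt {x \<in> ?F. g x = i}" by (subst sum_wt) auto
    then have "card (Vs i) \<le> 2 * T" using g(2) that by simp
    then have "real (card (Vs i)) \<le> 2 * s" using T by linarith
    also have "\<dots> \<le> C * s" using C s by (intro mult_right_mono) auto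
    finally show ?thesis .
  qed
  have nonadj: "\<not> adjacent G u v" if "i \<noteq> j" "u \<in> Vs i" "v \<in> Vs j" for i j u v
  proof
    assume "adjacent G u v"
    then have "real_of_int (linf_dist u v) \<le> real w" using adj c by fastforce
    moreover have "int w < linf_dist u v"
      using that len w t by (intro linf_dist_of_cell_neq[of w t B]) (auto simp: Vs_def S)
    ultimately show False by linarith
  qed
  show ?thesis
    unfolding pseudo_separator_def n[symmetric]
  proof (intro conjI exI[of _ "Suc h"] exI[of _ Vs])
    show "nodes G - S = (\<Union>i<Suc h. Vs i)" using g(1) by (auto simp: Vs_def less_Suc_eq_le)
    show "disjoint_family_on Vs {..<Suc h}" by (auto simp: disjoint_family_on_def Vs_def)
  qed (use S small h size nonadj in auto)
qed

text \<open>A single part with all nodes suffices, because \<open>C\<close> is at least their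
  number.\<close>

lemma trivial_pseudo_separator:
  assumes "finite (nodes G)" "1 \<le> s" "s \<le> real (card (nodes G))" "real (card (nodes G)) \<le> C" "0 \<le> c"
  shows "pseudo_separator C d c s G {}"
proof -
  have "1 \<le> C" using assms by linarith
  have "1 * 1 \<le> C * (real (card (nodes G)) / s)"
    using assms \<open>1 \<le> C\<close> by (intro mult_mono) auto
  moreover have "real (card (nodes G)) * 1 \<le> C * s"
    using assms \<open>1 \<le> C\<close> by (intro mult_mono) auto
  ultimately show ?thesis
    unfolding pseudo_separator_def using assms \<open>1 \<le> C\<close>
    by (intro conjI exI[of _ 1] exI[of _ "\<lambda>_. nodes G"]) (auto simp: disjoint_family_on_def)
qed

section \<open>Deterministic programs\<close>

text \<open>The distribution after \<open>r\<close> rounds is the point mass at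
  \<open>\<tau> r\<close>, so quantifying over its support means checking a single trace.\<close>

lemma las_vegas_of_trace:
  assumes init: "\<tau> 0 = \<sigma>\<^sub>0"
    and step: "\<And>r. mpc_round m P (\<tau> r) = return_pmf (\<tau> (Suc r))"
    and res: "\<And>r. respects_resources m b M P (\<tau> r)"
    and corr: "\<And>r. halted m (\<tau> r) \<Longrightarrow> correct (run_output m (\<tau> r))"
    and halt: "\<And>r. R \<le> r \<Longrightarrow> halted m (\<tau> r)"
  shows "las_vegas m b M P \<sigma>\<^sub>0 correct"
    and "measure_pmf.prob (mpc_run m P \<sigma>\<^sub>0 R) {\<sigma>. halted m \<sigma>} = 1"
proof -
  have run: "mpc_run m P \<sigma>\<^sub>0 r = return_pmf (\<tau> r)" for r
    by (induction r) (simp_all add: init step bind_return_pmf)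
  have prob: "measure_pmf.prob (mpc_run m P \<sigma>\<^sub>0 r) {\<sigma>. halted m \<sigma>} = 1" if "R \<le> r" for r
    using halt[OF that] by (simp add: run indicator_def)
  then show "measure_pmf.prob (mpc_run m P \<sigma>\<^sub>0 R) {\<sigma>. halted m \<sigma>} = 1" by simp
  have "(\<lambda>r. measure_pmf.prob (mpc_run m P \<sigma>\<^sub>0 r) {\<sigma>. halted m \<sigma>}) \<longlonglongrightarrow> 1"
    by (rule tendsto_eventually) (auto simp: eventually_sequentially intro!: exI[of _ R] prob)
  then show "las_vegas m b M P \<sigma>\<^sub>0 correct"
    using res corr by (auto simp: las_vegas_def run)
qed

lemma mpc_round_deterministic:
  assumes "\<And>i ws inbox. compute P i ws inbox = return_pmf (F i ws inbox)"
  shows "mpc_round m P \<sigma> = return_pmf (\<lambda>i. if i < m then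
      (case \<sigma> i of Active ws \<Rightarrow> F i ws (\<lambda>j. if j < m then message P \<sigma> j i else []) | Done ps \<Rightarrow> Done ps)
    else Done [])"
proof -
  have "mpc_round m P \<sigma> = Pi_pmf {..<m} (Done []) (\<lambda>i. return_pmf
      (case \<sigma> i of Active ws \<Rightarrow> F i ws (\<lambda>j. if j < m then message P \<sigma> j i else []) | Done ps \<Rightarrow> Done ps))"
    unfolding mpc_round_def by (rule arg_cong[where f = "Pi_pmf _ _"]) (auto simp: assms split: mstate.split)
  then show ?thesis by simp
qed

section \<open>The protocol\<close>

text \<open>Recovers the nodes from raw memory, a concatenation of records of \<open>k\<close> words
  that begin with the \<open>d\<close> coordinates.\<close>

definition points :: "nat \<Rightarrow> nat \<Rightarrow> word list \<Rightarrow> point list" where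
  "points k d ws = map (\<lambda>i. take d (drop (k * i) ws)) [0..<length ws div k]"

definition histogram :: "nat \<Rightarrow> nat \<Rightarrow> nat \<Rightarrow> point list \<Rightarrow> word list" where
  "histogram b w B ps = map (\<lambda>t. min (2 ^ b - 1) (length (filter (hit w B t) ps))) [0..<B]"

definition best :: "word list \<Rightarrow> nat" where
  "best a = arg_min_on ((!) a) {..<length a}"

text \<open>The machines form an \<open>f\<close>-ary tree in which \<open>i div f\<close> is the parent of \<open>i\<close>; the root \<open>0\<close> is
  its own parent, so that no machine plays a special role. The memory is the raw input at first and
  then \<open>r # t # a @ input\<close> with a round counter \<open>r\<close>, the best slab \<open>t\<close> known so far and a histogram
  \<open>a\<close> of length \<open>B\<close>. As \<open>k\<close> divides \<open>B\<close>, the two formats differ in their length modulo \<open>k\<close>.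
  Counters are capped at \<open>2 ^ b - 1\<close>, as a count may be as large as \<open>2 ^ b\<close>.\<close>

definition slab_step ::
    "nat \<Rightarrow> nat \<Rightarrow> nat \<Rightarrow> nat \<Rightarrow> nat \<Rightarrow> nat \<Rightarrow> nat \<Rightarrow> nat \<Rightarrow> nat \<Rightarrow> word list \<Rightarrow> (nat \<Rightarrow> word list) \<Rightarrow> mstate"
  where
  "slab_step k d b m w B f D i ws inbox =
     (if length ws mod k = 0 then
        (let a = histogram b w B (points k d ws) in Active (0 # best a # a @ ws))
      else (let r = ws ! 0; t = ws ! 1; a = take B (drop 2 ws); raw = drop (B + 2) ws in
        if r < D then
          (let a' = map (\<lambda>t. min (2 ^ b - 1) (\<Sum>j | j < m \<and> j div f = i. inbox j ! t)) [0..<B]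
           in Active (Suc r # best a' # a' @ raw))
        else if r < 2 * D then Active (Suc r # hd (inbox (i div f)) # a @ raw)
        else Done (filter (hit w B t) (points k d raw))))"

text \<open>The first round is local and builds the histograms. Then follow \<open>D\<close> rounds
  towards the root, \<open>D\<close> rounds away from it and one for the output,
  \<open>2 * D + 2\<close> in all.\<close>

definition slab_program ::
    "nat \<Rightarrow> nat \<Rightarrow> nat \<Rightarrow> nat \<Rightarrow> nat \<Rightarrow> nat \<Rightarrow> nat \<Rightarrow> nat \<Rightarrow> mpc_program" where
  "slab_program k d b m w B f D = \<lparr>
     send = (\<lambda>i ws j. if length ws mod k = 0 then []
       else if ws ! 0 < D then (if j = i div f then take B (drop 2 ws) else [])
       else if j div f = i then [ws ! 1] else []),
     compute = (\<lambda>i ws inbox. return_pmf (slab_step k d b m w B f D i ws inbox))\<rparr>"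

lemma points_concat:
  assumes "0 < k" "d \<le> k" "\<And>v. v \<in> set vs \<Longrightarrow> length (g v) = k \<and> take d (g v) = v"
  shows "points k d (concat (map g vs)) = vs"
proof -
  have len: "length (concat (map g vs)) = k * length vs"
    using assms(3) by (induction vs) auto
  have nth: "take d (drop (k * i) (concat (map g vs))) = vs ! i" if "i < length vs" for i
    using assms(3) that
  proof (induction vs arbitrary: i)
    case (Cons u us)
    have u: "length (g u) = k" "take d (g u) = u" using Cons.prems by auto
    show ?case
    proof (cases i)
      case 0
      then show ?thesis using u \<open>d \<le> k\<close> by simp
    next
      case (Suc i')
      then show ?thesis using u Cons by simp
    qed
  qed simp
  show ?thesis
    unfolding points_def len using nth assms(1) by (intro nth_equalityI) auto
qed

text \<open>For finite \<open>A\<close>, if a summand reaches \<open>N\<close>, both sides are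
  \<open>N\<close>; otherwise the inner caps do nothing. Hence capping at every level of the tree
  amounts to capping the total once.\<close>

lemma min_sum_min:
  fixes x :: "'a \<Rightarrow> nat"
  shows "min N (\<Sum>j\<in>A. min N (x j)) = min N (sum x A)"
  by (induction A rule: infinite_finite_induct) auto

lemma best_less: "a \<noteq> [] \<Longrightarrow> best a < length a"
  unfolding best_def using arg_min_if_finite(1)[of "{..<length a}" "(!) a"] by auto

lemma best_le: "t < length a \<Longrightarrow> a ! best a \<le> a ! t"
  unfolding best_def using arg_min_least[of "{..<length a}" t "(!) a"] by auto

text \<open>By \<open>3 \<le> k\<close> and \<open>k dvd B\<close> the two memory formats can be
  told apart; \<open>m \<le> f ^ D\<close> puts every machine within \<open>D\<close> levels of the
  root; the bounds by \<open>2 ^ b\<close> make slab indices and round counters fit into a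
  word.\<close>

locale slab_protocol =
  fixes G :: "point implicit_graph" and d k b m w B f D :: nat and c :: real and inp :: "nat \<Rightarrow> point list"
  assumes G: "implicit_grid_graph d c k b G"
    and inp: "evenly_distributed m (nodes G) inp"
    and k: "3 \<le> k" "d \<le> k" "k dvd B"
    and B: "0 < B" "B \<le> 2 ^ b"
    and D: "0 < f" "m \<le> f ^ D" "2 * D < 2 ^ b"
begin

definition count :: "nat \<Rightarrow> nat \<Rightarrow> nat" where
  "count t j = length (filter (hit w B t) (inp j))"

text \<open>The capped histogram of all machines whose \<open>r\<close>-th ancestor is
  \<open>i\<close>. A machine other than the root drops its own counts once they have moved to its
  parent.\<close>

definition acc :: "nat \<Rightarrow> nat \<Rightarrow> word list" where
  "acc r i = map (\<lambda>t. min (2 ^ b - 1) (\<Sum>j | j < m \<and> j div f ^ r = i. count t j)) [0..<B]"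

definition raw :: "nat \<Rightarrow> word list" where
  "raw i = concat (map (info G) (inp i))"

text \<open>While the histograms are added up, \<open>r - D = 0\<close>; afterwards \<open>i div f ^ (r - D)\<close> is the ancestor
  of \<open>i\<close> whose choice has reached it.\<close>

definition choice :: "nat \<Rightarrow> nat \<Rightarrow> nat" where
  "choice r i = best (acc (min r D) (i div f ^ (r - D)))"

definition mem :: "nat \<Rightarrow> nat \<Rightarrow> word list" where
  "mem r i = r # choice r i # acc (min r D) i @ raw i"

definition winner :: nat where
  "winner = best (acc D 0)"

text \<open>The run in closed form. The counter in memory lags one behind the round number, because
  the first round only sets up the memory.\<close>

definition trace :: "nat \<Rightarrow> config" where
  "trace r i = (if m \<le> i then Done [] else if r = 0 then Active (raw i)
     else if r \<le> Suc (2 * D) then Active (mem (r - 1) i)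
     else Done (filter (hit w B winner) (inp i)))"

abbreviation P :: mpc_program where
  "P \<equiv> slab_program k d b m w B f D"

lemma set_inp: "i < m \<Longrightarrow> set (inp i) \<subseteq> nodes G"
  using inp by (auto simp: evenly_distributed_def)

lemma info_inp:
  assumes "i < m" "v \<in> set (inp i)"
  shows "length (info G v) = k" "take d (info G v) = v" "length v = d" "words b (info G v)"
  using G set_inp[OF assms(1)] assms(2) by (auto simp: implicit_grid_graph_def implicit_graph_def)

lemma length_raw: "i < m \<Longrightarrow> length (raw i) = k * length (inp i)"
proof -
  assume i: "i < m"
  have "length (concat (map (info G) vs)) = k * length vs" if "set vs \<subseteq> set (inp i)" for vs
    using that info_inp(1)[OF i] by (induction vs) auto
  then show ?thesis by (simp add: raw_def)
qed

lemma points_raw: "i < m \<Longrightarrow> points k d (raw i) = inp i"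
  unfolding raw_def using k by (intro points_concat) (auto simp: info_inp)

lemma length_acc [simp]: "length (acc r i) = B"
  by (simp add: acc_def)

lemma acc_neq_Nil [simp]: "acc r i \<noteq> []"
  using B(1) length_acc[of r i] by fastforce

lemma choice_less: "choice r i < B"
  unfolding choice_def using best_less[OF acc_neq_Nil] by simp

lemma winner_less: "winner < B"
  unfolding winner_def using best_less[OF acc_neq_Nil] by simp

lemma mem_simps [simp]:
  "mem r i ! 0 = r" "mem r i ! Suc 0 = choice r i"
  "take B (drop 2 (mem r i)) = acc (min r D) i"
  "drop (B + 2) (mem r i) = raw i" "drop (Suc (Suc B)) (mem r i) = raw i"
  by (simp_all add: mem_def)

lemma length_mem: "i < m \<Longrightarrow> length (mem r i) = 2 + B + k * length (inp i)"
  by (simp add: mem_def length_raw)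

text \<open>As \<open>k dvd B\<close>, only the two leading words count modulo \<open>k\<close>, and
  \<open>3 \<le> k\<close> keeps this remainder nonzero; raw input has remainder 0.\<close>

lemma length_mem_mod: "i < m \<Longrightarrow> length (mem r i) mod k = 2"
proof -
  assume "i < m"
  obtain q where q: "B = k * q" using k(3) by blast
  have "length (mem r i) = 2 + (k * q + k * length (inp i))"
    unfolding length_mem[OF \<open>i < m\<close>] using q by linarith
  also have "\<dots> = 2 + k * (q + length (inp i))"
    by (simp add: algebra_simps)
  finally show ?thesis using k(1) by (simp only: mod_mult_self2) simp
qed

text \<open>The ancestor at level \<open>r + 1\<close> is the parent of the one at level
  \<open>r\<close>, so the sum can be regrouped; \<open>min_sum_min\<close> removes the inner
  caps.\<close>

lemma acc_Suc:
  "map (\<lambda>t. min (2 ^ b - 1) (\<Sum>j | j < m \<and> j div f = i. acc r j ! t)) [0..<B] = acc (Suc r) i"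
proof -
  have "min (2 ^ b - 1) (\<Sum>j | j < m \<and> j div f = i. acc r j ! t)
      = min (2 ^ b - 1) (\<Sum>j | j < m \<and> j div f ^ Suc r = i. count t j)" if "t < B" for t
  proof -
    let ?J = "{j. j < m \<and> j div f = i}" and ?I = "{l. l < m \<and> l div f ^ Suc r = i}"
    have "min (2 ^ b - 1) (\<Sum>j\<in>?J. acc r j ! t)
        = min (2 ^ b - 1) (\<Sum>j\<in>?J. \<Sum>l | l < m \<and> l div f ^ r = j. count t l)"
      using that by (simp add: acc_def min_sum_min)
    also have "(\<Sum>j\<in>?J. \<Sum>l | l < m \<and> l div f ^ r = j. count t l)
        = (\<Sum>j\<in>?J. \<Sum>l\<in>{l \<in> ?I. l div f ^ r = j}. count t l)"
      by (intro sum.cong refl) (auto simp: div_mult2_eq mult.commute[of f])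
    also have "\<dots> = (\<Sum>l\<in>?I. count t l)"
    proof (rule sum.group)
      show "(\<lambda>l. l div f ^ r) ` ?I \<subseteq> ?J"
        by (auto simp: div_mult2_eq mult.commute[of f] intro: le_less_trans[OF div_le_dividend])
    qed auto
    finally show ?thesis .
  qed
  then show ?thesis by (simp add: acc_def)
qed

lemma histogram_inp: "i < m \<Longrightarrow> histogram b w B (inp i) = acc 0 i"
proof -
  assume "i < m"
  then have "{j. j < m \<and> j div f ^ 0 = i} = {i}" by auto
  then show ?thesis unfolding histogram_def acc_def count_def by simp
qed

text \<open>On the way down a machine copies its parent, whose ancestor \<open>r - D\<close> levels
  up is its own ancestor one level further.\<close>

lemma choice_Suc: "D \<le> r \<Longrightarrow> choice r (i div f) = choice (Suc r) i"
  by (simp add: choice_def Suc_diff_le div_mult2_eq min_def)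

lemma choice_early: "r \<le> D \<Longrightarrow> choice r i = best (acc r i)"
  by (simp add: choice_def)

text \<open>After \<open>D\<close> downward rounds this ancestor is the root, since
  \<open>i < m \<le> f ^ D\<close>.\<close>

lemma choice_late: "i < m \<Longrightarrow> choice (2 * D) i = winner"
  using D(2) by (simp add: choice_def winner_def min_def)

section \<open>The run agrees with its closed form\<close>

lemma message_trace:
  assumes "i < m"
  shows "message P (trace r) i j =
    (if r = 0 \<or> Suc (2 * D) < r then []
     else if r - 1 < D then (if j = i div f then acc (r - 1) i else [])
     else if j div f = i then [choice (r - 1) i] else [])"
proof (cases "r = 0 \<or> Suc (2 * D) < r")
  case True
  then show ?thesis using assms length_raw[of i]
    by (auto simp: message_def trace_def slab_program_def)
next
  case False
  then show ?thesis using assms length_mem_mod[OF assms, of "r - 1"]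
    by (auto simp: message_def trace_def slab_program_def min_def)
qed

lemma step_trace: "mpc_round m P (trace r) = return_pmf (trace (Suc r))"
proof -
  have "(case trace r i of
      Active ws \<Rightarrow> slab_step k d b m w B f D i ws (\<lambda>j. if j < m then message P (trace r) j i else [])
    | Done ps \<Rightarrow> Done ps) = trace (Suc r) i" if i: "i < m" for i
  proof -
    let ?inbox = "\<lambda>j. if j < m then message P (trace r) j i else []"
    \<comment> \<open>The cases are the local round, the upward phase, the downward phase, the
      output round and the halted state.\<close>
    consider "r = 0" | "r > 0" "r - 1 < D" | "r > 0" "D \<le> r - 1" "r - 1 < 2 * D"
      | "r = Suc (2 * D)" | "Suc (2 * D) < r" by linarith
    then show ?thesis
    proof cases
      case 1
      then show ?thesis using i length_raw[OF i]
        by (simp add: trace_def slab_step_def mem_def points_raw histogram_inp choice_early Let_def)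
    next
      case 2
      have "(\<Sum>j | j < m \<and> j div f = i. ?inbox j ! t) = (\<Sum>j | j < m \<and> j div f = i. acc (r - 1) j ! t)" for t
        using 2 by (intro sum.cong refl) (auto simp: message_trace)
      then have "slab_step k d b m w B f D i (mem (r - 1) i) ?inbox = Active (mem r i)"
        using 2 i length_mem_mod[OF i, of "r - 1"] acc_Suc[where r = "r - 1" and i = i]
        by (simp add: slab_step_def Let_def mem_def[of r] choice_early min_absorb1)
      moreover have "r \<le> 2 * D" using 2 by linarith
      ultimately show ?thesis using 2 i by (simp add: trace_def)
    next
      case 3
      have "i div f < m" using i by (meson div_le_dividend le_less_trans)
      then have "?inbox (i div f) = [choice r i]"
        using 3 choice_Suc[of "r - 1" i] by (simp add: message_trace)
      then have "slab_step k d b m w B f D i (mem (r - 1) i) ?inbox = Active (mem r i)"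
        using 3 i length_mem_mod[OF i, of "r - 1"]
        by (simp add: slab_step_def Let_def mem_def[of r] min_absorb2)
      moreover have "r \<le> 2 * D" using 3 by linarith
      ultimately show ?thesis using 3 i by (simp add: trace_def)
    next
      case 4
      then show ?thesis using i length_mem_mod[OF i, of "2 * D"]
        by (simp add: trace_def slab_step_def Let_def points_raw choice_late)
    next
      case 5
      then show ?thesis using i by (simp add: trace_def)
    qed
  qed
  then show ?thesis
    by (subst mpc_round_deterministic[where F = "slab_step k d b m w B f D"])
      (auto simp: slab_program_def trace_def fun_eq_iff)
qed

lemma halted_trace: "Suc (Suc (2 * D)) \<le> r \<Longrightarrow> halted m (trace r)"
  by (simp add: halted_def trace_def)

section \<open>Word sizes and communication volume\<close>

lemma words_raw: "i < m \<Longrightarrow> words b (raw i)"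
  using info_inp(4) by (fastforce simp: words_def raw_def)

lemma words_acc: "words b (acc r i)"
proof -
  have "min (2 ^ b - 1) x < 2 ^ b" for x :: nat
    by (rule le_less_trans[OF min.cobounded1]) simp
  then show ?thesis by (auto simp: words_def acc_def)
qed

lemma words_mem: "i < m \<Longrightarrow> r \<le> 2 * D \<Longrightarrow> words b (mem r i)"
  using words_raw[of i] words_acc choice_less[of r i] B(2) D(3) by (auto simp: words_def mem_def)

lemma content_trace:
  assumes "i < m"
  shows "words b (content (trace r i))" "length (content (trace r i)) \<le> 2 + B + k * length (inp i)"
proof -
  \<comment> \<open>An output point takes \<open>d \<le> k\<close> words, so the output is never
    longer than the raw input.\<close>
  have "length (concat (filter Q vs)) \<le> k * length vs" if "set vs \<subseteq> set (inp i)" for Q vs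
    using that info_inp(3)[OF assms] k(2) by (induction vs) (auto intro: add_mono trans_le_add2)
  from this[OF subset_refl, of "hit w B winner"]
  show "length (content (trace r i)) \<le> 2 + B + k * length (inp i)"
    using assms by (simp add: trace_def length_raw length_mem)
  have "words b v" if "v \<in> set (inp i)" for v
    using info_inp(2,4)[OF assms that] by (metis in_set_takeD words_def)
  then show "words b (content (trace r i))"
    using assms words_raw[OF assms] words_mem[OF assms, of "r - 1"]
    by (auto simp: trace_def words_def)
qed

text \<open>A machine has at most \<open>f\<close> children. The upward phase is the expensive one,
  with up to \<open>f\<close> histograms of \<open>B\<close> words received; on the way down at most
  \<open>f\<close> single words are sent.\<close>

lemma respects_resources_trace:
  assumes M: "f * B \<le> M" "\<And>i. i < m \<Longrightarrow> 2 + B + k * length (inp i) \<le> M"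
  shows "respects_resources m b M P (trace r)"
proof -
  have "B \<le> f * B" "f \<le> f * B" using B(1) D(1) by simp_all
  then have BM: "B \<le> M" and fM: "f \<le> M" using M(1) by linarith+
  have card: "card {j. j < m \<and> j div f = i} \<le> f" for i
  proof -
    have "j \<in> {j div f * f..<j div f * f + f}" for j
      using div_mult_mod_eq[of j f] mod_less_divisor[OF D(1), of j]
      by (simp only: atLeastLessThan_iff) linarith
    then have "{j. j < m \<and> j div f = i} \<subseteq> {i * f..<i * f + f}" by auto
    from card_mono[OF _ this] show ?thesis by simp
  qed
  have children: "(\<Sum>j<m. if j div f = i then x else 0) \<le> f * x" for i x :: nat
    using mult_right_mono[OF card[of i], of x] by (simp add: sum.If_cases Int_def)
  have len: "length (message P (trace r) i j) \<le>
      (if r - 1 < D then (if j = i div f then B else 0) else if j div f = i then 1 else 0)" if "i < m" for i j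
    using that by (simp add: message_trace)
  have parent: "(\<Sum>j<m. if j = i then x else 0) \<le> x" for i x :: nat
    by (simp add: sum.delta)
  have sends: "(\<Sum>j<m. length (message P (trace r) i j)) \<le> M" if "i < m" for i
  proof -
    have "(\<Sum>j<m. length (message P (trace r) i j)) \<le> (\<Sum>j<m.
        (if r - 1 < D then (if j = i div f then B else 0) else if j div f = i then 1 else 0))"
      using that by (intro sum_mono len)
    then show ?thesis using parent[of "i div f" B] children[of i 1] BM fM
      by (cases "r - 1 < D") (simp_all del: sum.delta sum.delta')
  qed
  have receives: "(\<Sum>j<m. length (message P (trace r) j i)) \<le> M" if "i < m" for i
  proof -
    have "(\<Sum>j<m. length (message P (trace r) j i)) \<le> (\<Sum>j<m.
        (if r - 1 < D then (if j div f = i then B else 0) else if j = i div f then 1 else 0))"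
      by (rule sum_mono, rule order.trans[OF len]) auto
    then show ?thesis using parent[of "i div f" 1] children[of i B] M(1) BM B(1)
      by (cases "r - 1 < D") (simp_all del: sum.delta sum.delta')
  qed
  have "words b (message P (trace r) i j)" if "i < m" for i j
    using that words_acc[of "r - 1" i] choice_less[of "r - 1" i] B(2)
    by (auto simp: message_trace words_def)
  then show ?thesis
    unfolding respects_resources_def
    using content_trace order.trans[OF content_trace(2) M(2)] sends receives by simp
qed

section \<open>The output and its size\<close>

lemma not_halted_trace: "0 < m \<Longrightarrow> r \<le> Suc (2 * D) \<Longrightarrow> \<not> halted m (trace r)"
  by (auto simp: halted_def trace_def)

lemma output_trace:
  assumes "0 < m" "halted m (trace r)"
  shows "run_output m (trace r) = {v \<in> nodes G. hit w B winner v}"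
proof -
  have "\<not> r \<le> Suc (2 * D)" using not_halted_trace[OF assms(1)] assms(2) by blast
  then have "trace r i = Done (filter (hit w B winner) (inp i))" if "i < m" for i
    using that by (simp add: trace_def)
  then have "run_output m (trace r) = {v \<in> \<Union>i<m. set (inp i). hit w B winner v}"
    by (force simp: run_output_def)
  also have "(\<Union>i<m. set (inp i)) = nodes G"
    using inp by (simp add: evenly_distributed_def atLeast0LessThan)
  finally show ?thesis .
qed

lemma card_hit: "card {v \<in> nodes G. hit w B t v} = (\<Sum>j<m. count t j)"
proof -
  let ?L = "concat (map inp [0..<m])"
  have L: "distinct ?L" "set ?L = nodes G" using inp by (auto simp: evenly_distributed_def)
  have "(\<Sum>j<n. count t j) = length (filter (hit w B t) (concat (map inp [0..<n])))" for n
    by (induction n) (auto simp: count_def)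
  also have "length (filter (hit w B t) ?L) = card (set (filter (hit w B t) ?L))"
    using L(1) by (metis distinct_card distinct_filter)
  also have "set (filter (hit w B t) ?L) = {v \<in> nodes G. hit w B t v}"
    unfolding L(2)[symmetric] by auto
  finally show ?thesis by simp
qed

text \<open>There are at most \<open>2 ^ b\<close> nodes, so the cap can only confuse the counts
  \<open>2 ^ b - 1\<close> and \<open>2 ^ b\<close>; this is the summand 1.\<close>

lemma card_hit_winner:
  assumes "t < B"
  shows "card {v \<in> nodes G. hit w B winner v} \<le> card {v \<in> nodes G. hit w B t v} + 1"
proof -
  have "acc D 0 ! t = min (2 ^ b - 1) (card {v \<in> nodes G. hit w B t v})" if "t < B" for t
  proof -
    have "{j. j < m \<and> j div f ^ D = 0} = {..<m}" using D(2) by auto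
    then show ?thesis using that by (simp add: acc_def card_hit)
  qed
  then have "min (2 ^ b - 1) (card {v \<in> nodes G. hit w B winner v})
      \<le> min (2 ^ b - 1) (card {v \<in> nodes G. hit w B t v})"
    using best_le[of t "acc D 0"] assms winner_less by (simp add: winner_def[symmetric])
  moreover have "card {v \<in> nodes G. hit w B winner v} \<le> 2 ^ b"
  proof -
    have "finite (nodes G)" "card (nodes G) \<le> 2 ^ b"
      using G by (auto simp: implicit_grid_graph_def implicit_graph_def)
    moreover have "{v \<in> nodes G. hit w B winner v} \<subseteq> nodes G" by auto
    ultimately show ?thesis using card_mono le_trans by blast
  qed
  ultimately show ?thesis by linarith
qed

text \<open>The minimum is at most the average, which \<open>sum_card_hit_le\<close> bounds; the
  additional \<open>B\<close> collects the errors from capping.\<close>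

lemma card_hit_winner_le: "B * card {v \<in> nodes G. hit w B winner v} \<le> d * card (nodes G) + B"
proof -
  have "B * card {v \<in> nodes G. hit w B winner v} = (\<Sum>t<B. card {v \<in> nodes G. hit w B winner v})"
    by simp
  also have "\<dots> \<le> (\<Sum>t<B. card {v \<in> nodes G. hit w B t v} + 1)"
    by (intro sum_mono card_hit_winner) simp
  also have "\<dots> \<le> d * card (nodes G) + B"
    using sum_card_hit_le[of "nodes G" B d w] B(1) G
    by (simp only: sum.distrib) (simp add: implicit_grid_graph_def implicit_graph_def)
  finally show ?thesis .
qed

end

section \<open>The choice of the parameters\<close>

text \<open>For graphs of bounded size the empty separator is good enough.\<close>

definition idle_program :: mpc_program where
  "idle_program = \<lparr>send = (\<lambda>_ _ _. []), compute = (\<lambda>_ _ _. return_pmf (Done []))\<rparr>"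

lemma idle_program_correct:
  assumes G: "implicit_graph k b G" and inp: "evenly_distributed m (nodes G) inp"
    and m: "0 < m" and M: "\<And>i. i < m \<Longrightarrow> k * length (inp i) \<le> M" and corr: "correct {}" and R: "0 < R"
  shows "las_vegas m b M idle_program (initial_config m G inp) correct"
    and "measure_pmf.prob (mpc_run m idle_program (initial_config m G inp) R) {\<sigma>. halted m \<sigma>} = 1"
proof -
  define \<tau> :: "nat \<Rightarrow> config" where
    "\<tau> r = (if r = 0 then initial_config m G inp else (\<lambda>i. Done []))" for r
  have \<tau>: "mpc_round m idle_program (\<tau> r) = return_pmf (\<tau> (Suc r))" for r
    by (subst mpc_round_deterministic[where F = "\<lambda>_ _ _. Done []"])
      (auto simp: \<tau>_def idle_program_def initial_config_def fun_eq_iff)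
  have msg: "message idle_program \<sigma> i j = []" for \<sigma> i j
    by (simp add: message_def idle_program_def split: mstate.split)
  have content: "length (concat (map (info G) (inp i))) \<le> M" "words b (concat (map (info G) (inp i)))"
    if "i < m" for i
  proof -
    have info: "length (info G v) = k" "words b (info G v)" if "v \<in> set (inp i)" for v
      using G inp that \<open>i < m\<close> by (auto simp: implicit_graph_def evenly_distributed_def)
    have "length (concat (map (info G) vs)) = k * length vs" if "set vs \<subseteq> set (inp i)" for vs
      using that info(1) by (induction vs) auto
    then show "length (concat (map (info G) (inp i))) \<le> M" using M that by simp
    show "words b (concat (map (info G) (inp i)))"
      using info(2) by (fastforce simp: words_def)
  qed
  have res: "respects_resources m b M idle_program (\<tau> r)" for r
    using content by (auto simp: respects_resources_def msg \<tau>_def initial_config_def words_def)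
  have "\<not> halted m (\<tau> 0)" using m by (auto simp: halted_def \<tau>_def initial_config_def)
  then have out: "correct (run_output m (\<tau> r))" if "halted m (\<tau> r)" for r
    using that corr by (cases r) (simp_all add: \<tau>_def run_output_def)
  have halt: "halted m (\<tau> r)" if "R \<le> r" for r
    using that R by (simp add: \<tau>_def halted_def)
  have init: "\<tau> 0 = initial_config m G inp" by (simp add: \<tau>_def)
  show "las_vegas m b M idle_program (initial_config m G inp) correct"
    and "measure_pmf.prob (mpc_run m idle_program (initial_config m G inp) R) {\<sigma>. halted m \<sigma>} = 1"
    using las_vegas_of_trace[where \<tau> = \<tau> and R = R and correct = correct and b = b and M = "M",
      OF init \<tau> res out halt] by simp_all
qed

definition slab_width :: "real \<Rightarrow> nat" where
  "slab_width c = nat \<lceil>c\<rceil>"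

text \<open>For a positive slab width, the largest multiple of \<open>k\<close> whose product with
  the width is at most \<open>s powr (1 / d)\<close>; the memory format asks for a multiple of
  \<open>k\<close>.\<close>

definition slab_count :: "nat \<Rightarrow> nat \<Rightarrow> real \<Rightarrow> real \<Rightarrow> nat" where
  "slab_count k d c s = k * nat \<lfloor>s powr (1 / real d) / (real k * real (slab_width c))\<rfloor>"

text \<open>The factor 4 in the fifth bound pays for two roundings, each losing at most a factor of
  two: \<open>c\<close> up to \<open>w\<close>, and the quotient \<open>y\<close> down to
  \<open>q\<close>.\<close>

lemma slab_parameters:
  fixes s c :: real
  assumes k: "0 < k" and d: "0 < d" and s: "1 \<le> s" and c: "1 \<le> c" and le: "4 * real k * c \<le> s powr (1 / real d)"
  defines "w \<equiv> slab_width c" and "B \<equiv> slab_count k d c s"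
  shows "0 < w" "c \<le> real w" "0 < B" "real ((B * w) ^ d) \<le> s"
    "s powr (1 / real d) \<le> 4 * c * real B" "real B \<le> s powr (1 / real d)"
proof -
  define X where "X = s powr (1 / real d)"
  define y where "y = X / (real k * real w)"
  define q where "q = nat \<lfloor>y\<rfloor>"
  have B: "B = k * q" by (simp add: B_def slab_count_def q_def y_def X_def w_def)
  show w: "0 < w" "c \<le> real w" using c unfolding w_def slab_width_def by linarith+
  have w2: "real w \<le> 2 * c" using c unfolding w_def slab_width_def by linarith
  have X: "4 * real k * c \<le> X" using le by (simp add: X_def)
  have kw: "0 < real k * real w" using k w by simp
  have "2 * (real k * real w) \<le> 2 * (real k * (2 * c))" using w2 by (intro mult_left_mono) auto
  then have "2 * (real k * real w) \<le> X" using X by (simp add: mult_ac)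
  have "0 < z \<Longrightarrow> X / z * z = X" for z by simp
  from this[OF kw] have yX: "y * (real k * real w) = X"
    unfolding y_def .
  from \<open>2 * (real k * real w) \<le> X\<close> have y: "2 \<le> y" using kw by (simp add: y_def le_divide_eq)
  then have q: "real q \<le> y" "y \<le> 2 * real q" "0 < q" unfolding q_def by linarith+
  show "0 < B" using k q by (simp add: B)
  have "real (B * w) = real q * (real k * real w)" by (simp add: B mult_ac)
  also have "\<dots> \<le> y * (real k * real w)" using q kw by (intro mult_right_mono) auto
  also have "\<dots> = X" by (rule yX)
  finally have BwX: "real (B * w) \<le> X" .
  then have "real (B * w) ^ d \<le> X ^ d" by (intro power_mono) auto
  also have "X ^ d = s"
    using s d powr_realpow[of X d] by (simp add: X_def powr_powr)
  finally show "real ((B * w) ^ d) \<le> s" by simp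
  have "real B * 1 \<le> real B * real w" using w by (intro mult_left_mono) auto
  then show "real B \<le> s powr (1 / real d)" using BwX by (simp add: X_def)
  have "X = y * (real k * real w)" by (rule yX[symmetric])
  also have "\<dots> \<le> (2 * real q) * (real k * (2 * c))"
    using q w2 k y c by (intro mult_mono) auto
  also have "\<dots> = 4 * c * real B" by (simp add: B mult_ac)
  finally show "s powr (1 / real d) \<le> 4 * c * real B" by (simp add: X_def)
qed

lemma slab_program_correct:
  fixes s c :: real
  assumes G: "implicit_grid_graph d c k b G" and n: "n = card (nodes G)"
    and inp: "evenly_distributed m (nodes G) inp" and m: "0 < m" "m \<le> f ^ D"
    and d: "3 \<le> d" "d \<le> k" and s: "2 \<le> s" "s \<le> real n" and c: "1 \<le> c" "4 * real k * c \<le> s powr (1 / real d)"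
    and D: "0 < f" "2 * D < n" and C: "4 * (real d + 1) \<le> C"
  defines "w \<equiv> slab_width c" and "B \<equiv> slab_count k d c s"
  assumes M: "f * B \<le> M" "\<And>i. i < m \<Longrightarrow> 2 + B + k * length (inp i) \<le> M"
  shows "las_vegas m b M (slab_program k d b m w B f D) (initial_config m G inp) (pseudo_separator C d c s G)"
    and "measure_pmf.prob (mpc_run m (slab_program k d b m w B f D) (initial_config m G inp) (2 * D + 2))
      {\<sigma>. halted m \<sigma>} = 1"
proof -
  have "0 < k" "0 < d" "1 \<le> s" using d s by auto
  note par = slab_parameters[OF this c, folded w_def B_def]
  define X where "X = s powr (1 / real d)"
  have X: "X \<le> s" "0 < X" using s d powr_mono[of "1 / real d" 1 s] by (auto simp: X_def)
  have nb: "n \<le> 2 ^ b" using G by (simp add: n implicit_grid_graph_def implicit_graph_def)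
  have Bn: "B \<le> n" using par(6) X s unfolding X_def[symmetric] by linarith
  have kB: "k dvd B" by (simp add: B_def slab_count_def)
  have "3 \<le> k" "B \<le> 2 ^ b" "2 * D < 2 ^ b" using d D Bn nb by linarith+
  then interpret slab_protocol G d k b m w B f D c inp
    using G inp m d kB par(3) D by (intro slab_protocol.intro)
  have correct: "pseudo_separator C d c s G (run_output m (trace r))" if "halted m (trace r)" for r
  proof (rule slab_pseudo_separator[OF G n _ s(2) par(2,1) winner_less par(4) output_trace[OF m(1) that]])
    \<comment> \<open>\<open>B * ?x \<le> (d + 1) * n\<close> and \<open>X \<le> 4 * c * B\<close>
      together give the constant \<open>4 * (d + 1)\<close>. The factor \<open>log 2 s\<close> is
      then inserted for free, being at least 1 by \<open>2 \<le> s\<close>.\<close>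
    let ?x = "card (run_output m (trace r))"
    have "B * ?x \<le> d * n + B"
      using card_hit_winner_le by (simp add: output_trace[OF m(1) that] n)
    also have "\<dots> \<le> (d + 1) * n" using Bn by simp
    finally have "real B * real ?x \<le> (real d + 1) * real n"
      by (metis of_nat_1 of_nat_add of_nat_le_iff of_nat_mult)
    then have "4 * c * (real B * real ?x) \<le> 4 * c * ((real d + 1) * real n)"
      using c by (intro mult_left_mono) auto
    moreover have "X * real ?x \<le> 4 * c * real B * real ?x"
      using par(5) by (intro mult_right_mono) (auto simp: X_def)
    ultimately have "X * real ?x \<le> 4 * (real d + 1) * (c * real n)" by (simp add: mult_ac)
    then have "real ?x \<le> 4 * (real d + 1) * (c * real n / X)"
      using X by (simp add: pos_le_divide_eq mult.commute)
    also have "\<dots> \<le> C * (c * real n / X * log 2 s)"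
    proof (rule mult_mono[OF C])
      have "1 \<le> log 2 s" using s by (simp add: le_log_iff)
      then have "c * real n / X * 1 \<le> c * real n / X * log 2 s"
        using c X by (intro mult_left_mono) auto
      then show "c * real n / X \<le> c * real n / X * log 2 s" by simp
    qed (use C X c in auto)
    finally show "real ?x \<le> C * (c * real n / s powr (1 / real d) * log 2 s)" by (simp add: X_def)
  qed (use s C in auto)
  have init: "trace 0 = initial_config m G inp"
    by (auto simp: trace_def initial_config_def raw_def)
  have halt: "halted m (trace r)" if "2 * D + 2 \<le> r" for r
    using that halted_trace by simp
  show "las_vegas m b M P (initial_config m G inp) (pseudo_separator C d c s G)"
    and "measure_pmf.prob (mpc_run m P (initial_config m G inp) (2 * D + 2)) {\<sigma>. halted m \<sigma>} = 1"
    using las_vegas_of_trace[where \<tau> = trace and R = "2 * D + 2" and correct = "pseudo_separator C d c s G",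
      OF init step_trace respects_resources_trace[OF M] correct halt] by simp_all
qed

section \<open>Assembling the constants\<close>

lemma length_inp_le:
  fixes s \<mu> :: real
  assumes inp: "evenly_distributed m V inp" and "i < m"
    and "0 < s" "real (card V) / s \<le> \<mu> * real m"
  shows "real (length (inp i)) \<le> \<mu> * s + 1"
proof -
  have "int (length (inp i)) \<le> \<lceil>real (card V) / real m\<rceil>"
    using inp \<open>i < m\<close> by (auto simp: evenly_distributed_def)
  then have "real (length (inp i)) \<le> real (card V) / real m + 1" by linarith
  moreover have "real (card V) / real m \<le> \<mu> * s"
    using assms(2-4) by (simp add: field_simps)
  ultimately show ?thesis by linarith
qed

lemma nat_ceiling_bigtheta:
  assumes "0 < K" "0 < \<alpha>"
  shows "(\<lambda>n. real (nat \<lceil>K * real n powr \<alpha>\<rceil>)) \<in> \<Theta>(\<lambda>n. real n powr \<alpha>)"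
proof (rule bigthetaI')
  show "\<forall>\<^sub>F n in sequentially. K * norm (real n powr \<alpha>) \<le> norm (real (nat \<lceil>K * real n powr \<alpha>\<rceil>)) \<and>
    norm (real (nat \<lceil>K * real n powr \<alpha>\<rceil>)) \<le> (K + 1) * norm (real n powr \<alpha>)"
    using eventually_ge_at_top[of 1]
  proof eventually_elim
    case (elim n)
    have "1 \<le> real n powr \<alpha>" using elim assms by (intro ge_one_powr_ge_zero) auto
    moreover have "0 \<le> K * real n powr \<alpha>" using assms by simp
    moreover have "(K + 1) * real n powr \<alpha> = K * real n powr \<alpha> + real n powr \<alpha>"
      by (simp add: algebra_simps)
    ultimately show ?case by simp linarith
  qed
qed (use assms in auto)

theorem theorem16:
  fixes d k :: nat and \<alpha> \<mu> :: real
  assumes "d \<ge> 3" and "0 < \<alpha>" and "\<alpha> < 1" and "\<mu> \<ge> 1"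
  shows "\<exists>(M :: nat \<Rightarrow> nat) (A :: nat \<Rightarrow> nat \<Rightarrow> nat \<Rightarrow> real \<Rightarrow> formation_rule \<Rightarrow> mpc_program)
           (C :: real) (\<gamma> :: real) (R :: nat).
      (\<lambda>n. real (M n)) \<in> \<Theta>(\<lambda>n. real n powr \<alpha>) \<and> C > 0 \<and> \<gamma> > 0 \<and>
      (\<forall>(G :: point implicit_graph) (c :: real) (b :: nat) (n :: nat) (s :: real) (m :: nat) inp.
         implicit_grid_graph d c k b G \<longrightarrow>
         n = card (nodes G) \<longrightarrow> s = real n powr \<alpha> \<longrightarrow>
         1 \<le> c \<longrightarrow> c \<le> s powr (1 / real d ^ 3) \<longrightarrow>
         real n / s \<le> \<mu> * real m \<longrightarrow> real m \<le> \<mu> * (real n / s) \<longrightarrow>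
         evenly_distributed m (nodes G) inp \<longrightarrow>
         las_vegas m b (M n) (A n m b c (edge_rule G)) (initial_config m G inp)
           (pseudo_separator C d c s G) \<and>
         measure_pmf.prob (mpc_run m (A n m b c (edge_rule G)) (initial_config m G inp) R)
           {\<sigma>. halted m \<sigma>} \<ge> 1 - 1 / real n powr \<gamma>)"
proof -
  \<comment> \<open>The arity is at least \<open>n powr (\<alpha> / 2)\<close>, so depth
    \<open>D \<ge> 2 / \<alpha>\<close> makes room for \<open>n\<close> machines.\<close>
  define D where "D = nat \<lceil>2 / \<alpha>\<rceil>"
  define F where "F n = nat \<lceil>(real n powr \<alpha>) powr (1 / 2)\<rceil>" for n
  \<comment> \<open>A machine stores \<open>2 + B + k * length (inp i)\<close> words, with
    \<open>B \<le> s\<close> and at most \<open>\<mu> * s + 1\<close> input nodes; by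
    \<open>1 \<le> s\<close> this is at most \<open>K * s\<close>.\<close>
  define K where "K = 3 + real k * (\<mu> + 1)"
  define M where "M n = nat \<lceil>K * real n powr \<alpha>\<rceil>" for n
  have K: "0 < K" using assms by (simp add: K_def add_pos_nonneg)
  \<comment> \<open>For large \<open>n\<close> the gap between the exponents absorbs the factor
    \<open>4 * k\<close>, so that \<open>c \<le> s powr (1 / d ^ 3)\<close> implies
    \<open>4 * k * c \<le> s powr (1 / d)\<close>.\<close>
  have "1 / real d ^ 3 < 1 / real d"
  proof -
    have "real d ^ 1 < real d ^ 3" using assms by (intro power_strict_increasing) auto
    then show ?thesis using assms by (intro divide_strict_left_mono) auto
  qed
  then have "0 < 1 / real d - 1 / real d ^ 3" by simp
  then have gap: "\<forall>\<^sub>F n in sequentially. 4 * real k \<le> (real n powr \<alpha>) powr (1 / real d - 1 / real d ^ 3)"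
    using assms(2) by real_asymp
  have big: "\<forall>\<^sub>F n in sequentially. x \<le> real n powr \<alpha>" for x
    using assms(2) by real_asymp
  obtain N where N: "\<And>n. N \<le> n \<Longrightarrow> 4 * real k \<le> (real n powr \<alpha>) powr (1 / real d - 1 / real d ^ 3)
      \<and> \<mu> \<le> real n powr \<alpha> \<and> 2 \<le> real n powr \<alpha> \<and> 2 * D < n"
    using eventually_conj[OF gap eventually_conj[OF big[of \<mu>] eventually_conj[OF big[of 2]
      eventually_gt_at_top[of "2 * D"]]]]
    unfolding eventually_sequentially by blast
  define A :: "nat \<Rightarrow> nat \<Rightarrow> nat \<Rightarrow> real \<Rightarrow> formation_rule \<Rightarrow> mpc_program" where
    "A n m b c E = (if n < N then idle_program
       else slab_program k d b m (slab_width c) (slab_count k d c (real n powr \<alpha>)) (F n) D)" for n m b c E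
  \<comment> \<open>The first summand serves the slabs, the second the empty separator of graphs
    with fewer than \<open>N\<close> nodes.\<close>
  define C where "C = 4 * (real d + 1) + real N"
  have main: "las_vegas m b (M n) (A n m b c (edge_rule G)) (initial_config m G inp)
        (pseudo_separator C d c s G) \<and>
      measure_pmf.prob (mpc_run m (A n m b c (edge_rule G)) (initial_config m G inp) (2 * D + 2))
        {\<sigma>. halted m \<sigma>} = 1"
    if G: "implicit_grid_graph d c k b G" and n: "n = card (nodes G)" and s: "s = real n powr \<alpha>"
      and c: "1 \<le> c" "c \<le> s powr (1 / real d ^ 3)"
      and m: "real n / s \<le> \<mu> * real m" "real m \<le> \<mu> * (real n / s)"
      and inp: "evenly_distributed m (nodes G) inp"
    for G c b n s m inp
  proof -
    have G': "implicit_graph k b G" and fin: "finite (nodes G)" "nodes G \<noteq> {}"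
      using G by (auto simp: implicit_grid_graph_def implicit_graph_def)
    then have n0: "0 < n" by (simp add: n card_gt_0_iff)
    \<comment> \<open>Some node exists, and its \<open>d\<close> coordinates are a prefix of its
      \<open>k\<close> words.\<close>
    have dk: "d \<le> k"
      using G fin(2) by (fastforce simp: implicit_grid_graph_def implicit_graph_def)
    have s1: "1 \<le> s" "s \<le> real n"
      using n0 assms powr_mono[of \<alpha> 1 "real n"] by (auto simp: s ge_one_powr_ge_zero)
    have m0: "0 < m"
    proof (rule ccontr)
      assume "\<not> 0 < m"
      then show False using m(1) n0 s1(1) by (simp add: field_simps)
    qed
    have len: "real (length (inp i)) \<le> \<mu> * s + 1" if "i < m" for i
      using length_inp_le[OF inp that] s1(1) m(1) n by simp
    have MK: "K * s \<le> real (M n)" by (simp add: M_def s) linarith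
    have "2 + s + real k * real (length (inp i)) \<le> real (M n)" if "i < m" for i
    proof -
      have "2 + s + real k * real (length (inp i)) \<le> 2 * s + s + real k * (\<mu> * s + s)"
        using len[OF that] s1 by (intro add_mono mult_left_mono) auto
      also have "\<dots> = K * s" by (simp add: K_def algebra_simps)
      finally show ?thesis using MK by linarith
    qed
    note Mlen = this
    show ?thesis
    proof (cases "n < N")
      case True
      have "pseudo_separator C d c s G {}"
        using fin s1 c True n by (intro trivial_pseudo_separator) (auto simp: C_def)
      moreover have "k * length (inp i) \<le> M n" if "i < m" for i
      proof -
        have "real (k * length (inp i)) \<le> real (M n)" using Mlen[OF that] s1 by simp
        then show ?thesis by (simp only: of_nat_le_iff)
      qed
      ultimately show ?thesis
        using idle_program_correct[OF G' inp m0, of "M n" "pseudo_separator C d c s G" "2 * D + 2"] True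
        by (simp add: A_def)
    next
      case False
      then have large: "4 * real k \<le> s powr (1 / real d - 1 / real d ^ 3)" "\<mu> \<le> s" "2 \<le> s" "2 * D < n"
        using N[of n] by (auto simp: s)
      define B where "B = slab_count k d c s"
      have "4 * real k * c \<le> s powr (1 / real d - 1 / real d ^ 3) * s powr (1 / real d ^ 3)"
        using large c by (intro mult_mono) auto
      also have "\<dots> = s powr (1 / real d)" by (simp add: powr_add[symmetric])
      finally have kc: "4 * real k * c \<le> s powr (1 / real d)" .
      have Bd: "real B \<le> s powr (1 / real d)"
        unfolding B_def using assms(1) dk s1 c kc by (intro slab_parameters(6)) auto
      \<comment> \<open>Since \<open>d \<ge> 3\<close>, a histogram is short enough for
        \<open>F n\<close> of them to take at most \<open>2 * s\<close> words.\<close>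
      have Bhalf: "real B \<le> s powr (1 / 2)"
        using Bd powr_mono[of "1 / real d" "1 / 2" s] assms(1) s1 by (simp add: field_simps)
      have half1: "1 \<le> s powr (1 / 2)" using s1 by (simp add: ge_one_powr_ge_zero)
      have sq: "s powr (1 / 2) * s powr (1 / 2) = s" using s1 by (simp add: powr_add[symmetric])
      have F: "s powr (1 / 2) \<le> real (F n)" "real (F n) \<le> 2 * s powr (1 / 2)"
        using half1 unfolding F_def s[symmetric] by linarith+
      have "real (F n) * real B \<le> 2 * s powr (1 / 2) * s powr (1 / 2)"
        using F Bhalf by (intro mult_mono) auto
      also have "\<dots> = 2 * s" using sq by simp
      also have "\<dots> \<le> K * s" using s1 assms by (intro mult_right_mono) (auto simp: K_def)
      finally have FB: "F n * B \<le> M n" using MK by (metis of_nat_le_iff of_nat_mult order_trans)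
      have Bs: "real B \<le> s" using Bhalf mult_left_mono[OF half1, of "s powr (1 / 2)"] sq by simp
      have mem: "2 + B + k * length (inp i) \<le> M n" if "i < m" for i
      proof -
        have "real (2 + B + k * length (inp i)) \<le> real (M n)" using Mlen[OF that] Bs by simp
        then show ?thesis by (simp only: of_nat_le_iff)
      qed
      have "real m \<le> \<mu> / s * real n" using m(2) by simp
      also have "\<dots> \<le> 1 * real n" using large s1 by (intro mult_right_mono) auto
      also have "\<dots> = real n powr 1" using n0 by simp
      also have "\<dots> \<le> real n powr (\<alpha> * (1 / 2) * real D)"
      proof (rule powr_mono)
        have "2 / \<alpha> \<le> real D" unfolding D_def by linarith
        then show "1 \<le> \<alpha> * (1 / 2) * real D" using assms by (simp add: field_simps)
      qed (use n0 in simp)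
      also have "\<dots> = (s powr (1 / 2)) ^ D"
        using s1 by (simp add: s powr_powr powr_realpow[symmetric])
      also have "\<dots> \<le> real (F n) ^ D" using F by (intro power_mono) auto
      finally have mF: "m \<le> F n ^ D" by (metis of_nat_le_iff of_nat_power)
      have F0: "0 < F n" using F half1 by linarith
      have C: "4 * (real d + 1) \<le> C" by (simp add: C_def)
      show ?thesis
        using slab_program_correct[OF G n inp m0 mF assms(1) dk large(3) s1(2) c(1) kc F0 large(4) C
            FB[unfolded B_def] mem[unfolded B_def]] False
        by (simp add: A_def s)
    qed
  qed
  have Theta: "(\<lambda>n. real (M n)) \<in> \<Theta>(\<lambda>n. real n powr \<alpha>)"
    unfolding M_def using K assms(2) by (rule nat_ceiling_bigtheta)
  have "0 < C" by (simp add: C_def add_pos_nonneg)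
  \<comment> \<open>Halting within \<open>2 * D + 2\<close> rounds is certain, so
    \<open>\<gamma> = 1\<close> is an arbitrary positive choice.\<close>
  then show ?thesis
    using Theta main
    by (intro exI[of _ M] exI[of _ A] exI[of _ C] exI[of _ "1 :: real"] exI[of _ "2 * D + 2"]) auto
qed

end
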